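(* Let $\mathcal{G}$ be a temporal graph with $m$ snapshots on $n$ vertices, let $\beta$ be the constant swap cost, and let $\mathcal{L}$ and $\mathcal{C}$ be the associated $nm\times nm$ matrices. A relaxed solution for the sparsest temporal cut problem can be computed as $$\mathbf{x}^*=\operatorname*{arg\,max}_{\mathbf{x}\in[-1,1]^{nm}}\ \frac{\mathbf{x}^{\intercal}\left[3(n+2\beta)\mathcal{C}-\mathcal{L}\right]\mathbf{x}}{\mathbf{x}^{\intercal}\mathbf{x}},$$ which is the largest eigenvector of $3(n+2\beta)\mathcal{C}-\mathcal{L}$ (an eigenvector associated with its largest eigenvalue). That is, this $\mathbf{x}^*$ satisfies $$\mathbf{x}^*\in\operatorname*{arg\,min}_{\mathbf{x}\in[-1,1]^{nm},\ \mathbf{x}^{\intercal}\mathcal{C}\mathbf{x}>0}\ \frac{\mathbf{x}^{\intercal}\mathcal{L}\mathbf{x}}{\mathbf{x}^{\intercal}\mathcal{C}\mathbf{x}}.$$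
   Context: A temporal graph $\mathcal{G}=\langle G_1,\dots,G_m\rangle$ is a sequence of undirected weighted graphs (snapshots) $G_t=(V,E_t,W_t)$ on a common vertex set $V$ with $|V|=n$, with $W_t:E_t\to\mathbb{R}$. Let $L_t=D_t-A_t$ be the weighted Laplacian of $G_t$, where $A_t$ is the weighted adjacency matrix and $D_t$ the diagonal matrix of degrees. Vectors in $\mathbb{R}^{nm}$ have entries indexed by $v_t$ ($v\in V$, $1\le t\le m$), grouped into $m$ consecutive blocks of size $n$. The Laplacian of the temporal graph is $\mathcal{L}=\mathbf{diag}(L_1,\dots,L_m)+\beta\,(L^I\otimes I_n)$, where $L^I$ is the $m\times m$ unweighted Laplacian of the path (line) graph on $1,\dots,m$; thus $\mathcal{L}$ is the Laplacian of the graph on $\{v_t\}$ that contains all the snapshots together with edges $(v_t,v_{t+1})$ of weight $\beta$. Let $C=nI_n-\mathbf{1}_{n\times n}$ (Laplacian of the complete graph; $\mathbf{1}_{n\times n}$ is the all-ones matrix) and $\mathcal{C}=I_m\otimes C$. The sparsest temporal cut problem, in spectral form, is to minimize $\mathbf{x}^{\intercal}\mathcal{L}\mathbf{x}/\mathbf{x}^{\intercal}\mathcal{C}\mathbf{x}$ over indicator vectors $\mathbf{x}\in\{-1,1\}^{nm}$ of temporal cuts (sequences of vertex bipartitions $(X_t,\overline{X}_t)$ of $V$, one per snapshot, with $\mathbf{x}[v_t]=1$ if $v\in X_t$ and $-1$ if $v\in\overline{X}_t$) with $\mathbf{x}^{\intercal}\mathcal{C}\mathbf{x}>0$. A relaxed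 solution is a minimizer when $\{-1,1\}^{nm}$ is replaced with $[-1,1]^{nm}$.
   Formalization: Formalized for n ≥ 2, β ≥ 0 and x ≠ 0 in the quotient; the argmin claim is proved for every maximizer with x^T C x > 0, and for all maximizers when every edge weight is < 3(n+2β), since for large weights the maximizer can be a constant vector, which is infeasible. *)

theory Defs
  imports "HOL-Analysis.Analysis"
begin

text \<open>
  The vertex set is the finite type \<open>'v\<close>, so $n$ is \<open>CARD('v)\<close>. The snapshots are indexed by a
  finite linearly ordered type \<open>'m\<close>, so $m$ is \<open>CARD('m)\<close>; only the order on \<open>'m\<close> is used. A vector
  in $\mathbb{R}^{nm}$ has type \<open>real ^ ('m \<times> 'v)\<close>, and its entry for the copy $v_t$ of the vertex
  \<open>v\<close> in snapshot \<open>t\<close> is \<open>x $ (t, v)\<close>; the blocks are the sets of entries with a common \<open>t\<close>.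

  A temporal graph is a pair of functions: \<open>E t\<close> is the edge set of snapshot \<open>t\<close> and \<open>W t e\<close> the
  weight of the edge \<open>e\<close>. The values of \<open>W t\<close> outside \<open>E t\<close> are never used.
\<close>

definition temporal_graph :: "('m \<Rightarrow> 'v set set) \<Rightarrow> bool" where
  "temporal_graph E \<longleftrightarrow> (\<forall>t. \<forall>e \<in> E t. card e = 2)"

definition adjacency :: "'v set set \<Rightarrow> ('v set \<Rightarrow> real) \<Rightarrow> real ^ 'v::finite ^ 'v" where
  "adjacency F w = (\<chi> u v. if {u, v} \<in> F then w {u, v} else 0)"

definition degree_matrix :: "real ^ 'i::finite ^ 'i \<Rightarrow> real ^ 'i ^ 'i" where
  "degree_matrix A = (\<chi> i j. if i = j then (\<Sum>k\<in>UNIV. A $ i $ k) else 0)"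

definition laplacian :: "real ^ 'i::finite ^ 'i \<Rightarrow> real ^ 'i ^ 'i" where
  "laplacian A = degree_matrix A - A"

definition consecutive :: "'m::linorder \<Rightarrow> 'm \<Rightarrow> bool" where
  "consecutive s t \<longleftrightarrow> s < t \<and> \<not> (\<exists>r. s < r \<and> r < t)"

definition path_laplacian :: "real ^ 'm::{finite,linorder} ^ 'm::{finite,linorder}" where
  "path_laplacian = laplacian (\<chi> s t. if consecutive s t \<or> consecutive t s then 1 else 0)"

definition block_diag :: "('m::finite \<Rightarrow> real ^ 'v::finite ^ 'v) \<Rightarrow> real ^ ('m \<times> 'v) ^ ('m \<times> 'v)" where
  "block_diag B = (\<chi> i j. if fst i = fst j then B (fst i) $ snd i $ snd j else 0)"

definition kronecker :: "real ^ 'm::finite ^ 'm \<Rightarrow> real ^ 'v::finite ^ 'v \<Rightarrow> real ^ ('m \<times> 'v) ^ ('m \<times> 'v)" where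
  "kronecker A B = (\<chi> i j. A $ fst i $ fst j * B $ snd i $ snd j)"

definition temporal_laplacian ::
    "('m::{finite,linorder} \<Rightarrow> 'v::finite set set) \<Rightarrow> ('m \<Rightarrow> 'v set \<Rightarrow> real) \<Rightarrow> real
      \<Rightarrow> real ^ ('m \<times> 'v) ^ ('m \<times> 'v)" where
  "temporal_laplacian E W \<beta> =
     block_diag (\<lambda>t. laplacian (adjacency (E t) (W t)))
     + \<beta> *\<^sub>R kronecker path_laplacian (mat 1)"

definition complete_laplacian :: "real ^ 'v::finite ^ 'v" where
  "complete_laplacian = real CARD('v) *\<^sub>R mat 1 - (\<chi> u v. 1)"

definition temporal_complete :: "real ^ ('m::finite \<times> 'v::finite) ^ ('m \<times> 'v)" where
  "temporal_complete = kronecker (mat 1) complete_laplacian"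

definition quad_form :: "real ^ 'i::finite ^ 'i \<Rightarrow> real ^ 'i \<Rightarrow> real" where
  "quad_form M x = x \<bullet> (M *v x)"

text \<open>
  The entries of the candidate vectors range over \<open>D\<close>: the set \<open>{-1, 1}\<close> gives the indicator vectors
  of temporal cuts, and the interval \<open>{-1..1}\<close> gives the relaxation.
\<close>

definition sparsest_cut_minimizer ::
    "real set \<Rightarrow> ('m::{finite,linorder} \<Rightarrow> 'v::finite set set) \<Rightarrow> ('m \<Rightarrow> 'v set \<Rightarrow> real) \<Rightarrow> real
      \<Rightarrow> real ^ ('m \<times> 'v) \<Rightarrow> bool" where
  "sparsest_cut_minimizer D E W \<beta> =
     is_arg_min (\<lambda>x. quad_form (temporal_laplacian E W \<beta>) x / quad_form temporal_complete x)
       (\<lambda>x. (\<forall>i. x $ i \<in> D) \<and> quad_form temporal_complete x > 0)"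

definition relaxed_solution ::
    "('m::{finite,linorder} \<Rightarrow> 'v::finite set set) \<Rightarrow> ('m \<Rightarrow> 'v set \<Rightarrow> real) \<Rightarrow> real
      \<Rightarrow> real ^ ('m \<times> 'v) \<Rightarrow> bool" where
  "relaxed_solution E W \<beta> = sparsest_cut_minimizer {-1..1} E W \<beta>"

definition cut_matrix ::
    "('m::{finite,linorder} \<Rightarrow> 'v::finite set set) \<Rightarrow> ('m \<Rightarrow> 'v set \<Rightarrow> real) \<Rightarrow> real
      \<Rightarrow> real ^ ('m \<times> 'v) ^ ('m \<times> 'v)" where
  "cut_matrix E W \<beta> =
     (3 * (real CARD('v) + 2 * \<beta>)) *\<^sub>R temporal_complete - temporal_laplacian E W \<beta>"

text \<open>The zero vector is excluded because the Rayleigh quotient is undefined there.\<close>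

definition rayleigh_maximizer :: "real ^ 'i::finite ^ 'i \<Rightarrow> real ^ 'i \<Rightarrow> bool" where
  "rayleigh_maximizer M =
     is_arg_max (\<lambda>x. quad_form M x / (x \<bullet> x)) (\<lambda>x. (\<forall>i. x $ i \<in> {-1..1}) \<and> x \<noteq> 0)"

definition eigenvector :: "real ^ 'i::finite ^ 'i \<Rightarrow> real ^ 'i \<Rightarrow> real \<Rightarrow> bool" where
  "eigenvector M x \<mu> \<longleftrightarrow> x \<noteq> 0 \<and> M *v x = \<mu> *\<^sub>R x"

definition largest_eigenvector :: "real ^ 'i::finite ^ 'i \<Rightarrow> real ^ 'i \<Rightarrow> bool" where
  "largest_eigenvector M x \<longleftrightarrow>
     (\<exists>\<mu>. eigenvector M x \<mu> \<and> (\<forall>y \<nu>. eigenvector M y \<nu> \<longrightarrow> \<nu> \<le> \<mu>))"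

end

theory Submission
  imports Defs
begin

text \<open>
  Let $K = 3(n + 2\beta)$ and $M = K\mathcal{C} - \mathcal{L}$. Split a vector as $x = u + p$, where
  $u$ is constant on every block (the block means) and $p$ has block sums zero. Both quadratic forms
  are additive along this splitting, $\mathcal{C}$ vanishes on the vectors $u$ and is $n$ times the
  squared norm on the vectors $p$, and $\mathcal{L}$ is nonnegative on the vectors $u$. The largest
  eigenvalue $\lambda$ of $M$ is nonnegative because $M$ kills the constant vectors. So if $x$ attains
  $\lambda$, then both parts do, which forces $u^T\mathcal{L}u = 0$ and the quotient
  $K - \lambda/n$ at $x$, a lower bound for all admissible vectors. If all weights are less than $K$,
  then $M$ is positive at a vector that is nonconstant on the vertices and the same in all snapshots,
  so $\lambda > 0$, $u = 0$, and $x^T\mathcal{C}x > 0$ holds automatically.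
\<close>

section \<open>Maximizers of the Rayleigh quotient\<close>

lemma quad_form_scaleR: "quad_form M (c *\<^sub>R x) = c\<^sup>2 * quad_form M x"
  by (simp add: quad_form_def matrix_vector_mult_scaleR power2_eq_square)

lemma quad_form_matrix_scaleR: "quad_form (c *\<^sub>R A) x = c * quad_form A x"
  by (simp add: quad_form_def scaleR_matrix_vector_assoc[symmetric])

lemma quad_form_add: "quad_form (A + B) x = quad_form A x + quad_form B x"
  by (simp add: quad_form_def matrix_vector_mult_add_rdistrib inner_add_right)

lemma quad_form_diff: "quad_form (A - B) x = quad_form A x - quad_form B x"
  by (simp add: quad_form_def matrix_vector_mult_diff_rdistrib inner_diff_right)

lemma quad_form_mat_1: "quad_form (mat 1) x = x \<bullet> x"
  by (simp add: quad_form_def)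

lemma inner_symmetric_matrix:
  fixes M :: "real ^ 'i::finite ^ 'i"
  assumes "transpose M = M"
  shows "(M *v x) \<bullet> y = x \<bullet> (M *v y)"
  by (metis assms dot_lmul_matrix transpose_matrix_vector)

text \<open>Along the line \<open>x + t *\<^sub>R y\<close> with \<open>y = N *v x\<close> the form
  has value 0 and slope \<open>2 * (y \<bullet> y)\<close> at \<open>t = 0\<close>. Unless
  \<open>y = 0\<close>, a small step in the negative direction would make it negative.\<close>

lemma psd_quad_form_eq_0_imp_kernel:
  fixes N :: "real ^ 'i::finite ^ 'i"
  assumes sym: "transpose N = N"
    and psd: "\<And>y. quad_form N y \<ge> 0"
    and "quad_form N x = 0"
  shows "N *v x = 0"
proof -
  define y where "y = N *v x"
  define b where "b = quad_form N y"
  \<comment> \<open>The minimum over \<open>t\<close> of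
    \<open>2 * t * (y \<bullet> y) + t\<^sup>2 * b\<close> lies at
    \<open>- (y \<bullet> y) / b\<close>. Taking \<open>b + 1\<close> as denominator also covers
    \<open>b = 0\<close> and still gives a negative value when \<open>y\<close> is nonzero.\<close>
  define t where "t = - (y \<bullet> y) / (b + 1)"
  have b: "b \<ge> 0"
    by (simp add: b_def psd)
  have xy: "x \<bullet> (N *v y) = y \<bullet> y" "y \<bullet> (N *v x) = y \<bullet> y"
    using inner_symmetric_matrix[OF sym, of x y] by (simp_all add: y_def)
  have "quad_form N (x + t *\<^sub>R y) = quad_form N x + 2 * t * (y \<bullet> y) + t\<^sup>2 * b"
    using xy by (simp add: quad_form_def b_def matrix_vector_right_distrib
        matrix_vector_mult_scaleR inner_add_left inner_add_right power2_eq_square algebra_simps)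
  also have "\<dots> = - (y \<bullet> y)\<^sup>2 * (b + 2) / (b + 1)\<^sup>2"
    using b assms(3) by (simp add: t_def power2_eq_square divide_simps) (simp add: algebra_simps)
  finally have "(y \<bullet> y)\<^sup>2 * ((b + 2) / (b + 1)\<^sup>2) \<le> 0"
    using psd[of "x + t *\<^sub>R y"] by simp
  moreover have "(b + 2) / (b + 1)\<^sup>2 > 0"
    using b by simp
  ultimately have "(y \<bullet> y)\<^sup>2 \<le> 0"
    by (metis mult_le_0_iff not_less)
  then show ?thesis
    by (simp add: y_def)
qed

lemma scale_into_box:
  fixes y :: "real ^ 'i::finite"
  assumes "y \<noteq> 0"
  shows "\<forall>i. ((1 / norm y) *\<^sub>R y) $ i \<in> {-1..1}"
proof
  fix i
  have "\<bar>y $ i\<bar> \<le> norm y"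
    by (rule component_le_norm_cart)
  then show "((1 / norm y) *\<^sub>R y) $ i \<in> {-1..1}"
    using assms by (auto simp: divide_simps abs_le_iff)
qed

text \<open>The quotient is invariant under scaling and every nonzero vector has a multiple in the
  box, so a maximizer over the box is a maximizer over all nonzero vectors. Multiplied out, the
  inequality makes sense at 0 as well.\<close>

lemma rayleigh_maximizer_iff:
  "rayleigh_maximizer M x \<longleftrightarrow>
    (\<forall>i. x $ i \<in> {-1..1}) \<and> x \<noteq> 0 \<and>
    (\<forall>y. quad_form M y \<le> (quad_form M x / (x \<bullet> x)) * (y \<bullet> y))"
    (is "?L \<longleftrightarrow> ?R")
proof
  assume L: ?L
  have "quad_form M y \<le> (quad_form M x / (x \<bullet> x)) * (y \<bullet> y)" for y
  proof (cases "y = 0")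
    case False
    define z where "z = (1 / norm y) *\<^sub>R y"
    have "z \<bullet> z = 1"
      using False by (simp add: z_def dot_square_norm power2_eq_square)
    moreover have "z \<noteq> 0"
      using False by (simp add: z_def)
    ultimately have "quad_form M z \<le> quad_form M x / (x \<bullet> x)"
      using L scale_into_box[OF False]
      unfolding rayleigh_maximizer_def is_arg_max_def z_def[symmetric]
      by (metis div_by_1 not_less)
    moreover have "quad_form M z = quad_form M y / (y \<bullet> y)"
      by (simp add: z_def quad_form_scaleR power_divide dot_square_norm)
    ultimately show ?thesis
      using False by (simp add: pos_divide_le_eq)
  qed (simp add: quad_form_def)
  with L show ?R
    by (simp add: rayleigh_maximizer_def is_arg_max_def)
next
  assume R: ?R
  have "quad_form M y / (y \<bullet> y) \<le> quad_form M x / (x \<bullet> x)" if "y \<noteq> 0" for y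
    using R that by (simp add: pos_divide_le_eq)
  with R show ?L
    by (auto simp: rayleigh_maximizer_def is_arg_max_def not_less)
qed

text \<open>The unit sphere is compact, lies in the box and meets every ray from the origin.\<close>

lemma rayleigh_maximizer_exists:
  fixes M :: "real ^ 'i::finite ^ 'i"
  shows "\<exists>x. rayleigh_maximizer M x"
proof -
  have "compact (sphere 0 1 :: (real ^ 'i) set)" "sphere 0 1 \<noteq> ({} :: (real ^ 'i) set)"
    by auto
  moreover have "continuous_on (sphere 0 1) (quad_form M)"
    unfolding quad_form_def by (intro continuous_intros matrix_vector_mult_linear_continuous_on)
  ultimately obtain x where x: "x \<in> sphere 0 1"
    and max: "\<And>y. y \<in> sphere 0 1 \<Longrightarrow> quad_form M y \<le> quad_form M x"
    by (metis continuous_attains_sup)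
  have "quad_form M y \<le> quad_form M x * (y \<bullet> y)" for y
  proof (cases "y = 0")
    case False
    then have "quad_form M ((1 / norm y) *\<^sub>R y) \<le> quad_form M x"
      by (intro max) simp
    then show ?thesis
      using False by (simp add: quad_form_scaleR power_divide dot_square_norm pos_divide_le_eq)
  qed (simp add: quad_form_def)
  moreover have "x \<noteq> 0" "x \<bullet> x = 1"
    using x by (auto simp: dot_square_norm)
  moreover have "\<forall>i. x $ i \<in> {-1..1}"
    using scale_into_box[OF \<open>x \<noteq> 0\<close>] x by simp
  ultimately show ?thesis
    by (auto simp: rayleigh_maximizer_iff)
qed

text \<open>With \<open>l\<close> the maximal quotient, \<open>l *\<^sub>R mat 1 - M\<close> is
  positive semidefinite and its form vanishes at \<open>x\<close>, so \<open>x\<close> lies in its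
  kernel.\<close>

lemma rayleigh_maximizer_imp_eigenvector:
  fixes M :: "real ^ 'i::finite ^ 'i"
  assumes "transpose M = M" and max: "rayleigh_maximizer M x"
  shows "eigenvector M x (quad_form M x / (x \<bullet> x))"
proof -
  define l where "l = quad_form M x / (x \<bullet> x)"
  define N where "N = l *\<^sub>R mat 1 - M"
  have x: "x \<noteq> 0" and le: "\<And>y. quad_form M y \<le> l * (y \<bullet> y)"
    using max by (auto simp: rayleigh_maximizer_iff l_def)
  have N: "quad_form N y = l * (y \<bullet> y) - quad_form M y" for y
    by (simp add: N_def quad_form_diff quad_form_matrix_scaleR quad_form_mat_1)
  have "N *v x = 0"
  proof (rule psd_quad_form_eq_0_imp_kernel)
    show "transpose N = N"
      using assms(1) by (simp add: N_def transpose_def vec_eq_iff mat_def)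
    show "quad_form N y \<ge> 0" for y
      using le by (simp add: N)
    show "quad_form N x = 0"
      using x by (simp add: N l_def)
  qed
  then show ?thesis
    using x by (simp add: eigenvector_def l_def[symmetric] N_def matrix_vector_mult_diff_rdistrib
        scaleR_matrix_vector_assoc[symmetric])
qed

lemma eigenvector_rayleigh:
  assumes "eigenvector M x \<mu>"
  shows "quad_form M x / (x \<bullet> x) = \<mu>"
  using assms by (simp add: eigenvector_def quad_form_def)

lemma rayleigh_maximizer_iff_largest_eigenvector:
  fixes M :: "real ^ 'i::finite ^ 'i"
  assumes sym: "transpose M = M"
  shows "rayleigh_maximizer M x \<longleftrightarrow> (\<forall>i. x $ i \<in> {-1..1}) \<and> largest_eigenvector M x"
    (is "?L \<longleftrightarrow> ?R")
proof
  assume L: ?L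
  have "\<nu> \<le> quad_form M x / (x \<bullet> x)" if "eigenvector M y \<nu>" for y \<nu>
  proof -
    have "y \<bullet> y > 0" "quad_form M y = \<nu> * (y \<bullet> y)"
      using that by (auto simp: eigenvector_def quad_form_def)
    moreover have "quad_form M y \<le> (quad_form M x / (x \<bullet> x)) * (y \<bullet> y)"
      using L by (simp add: rayleigh_maximizer_iff)
    ultimately show ?thesis
      by (metis mult_le_cancel_right_pos)
  qed
  with L rayleigh_maximizer_imp_eigenvector[OF sym L] show ?R
    unfolding largest_eigenvector_def rayleigh_maximizer_iff by blast
next
  assume R: ?R
  then obtain \<mu> where \<mu>: "eigenvector M x \<mu>" "\<And>y \<nu>. eigenvector M y \<nu> \<Longrightarrow> \<nu> \<le> \<mu>"
    by (auto simp: largest_eigenvector_def)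
  \<comment> \<open>The quotient of some maximizer \<open>z\<close> is itself an eigenvalue, hence
    at most \<open>\<mu>\<close>. So \<open>\<mu>\<close> bounds the quotient everywhere, and
    \<open>x\<close> attains it.\<close>
  obtain z where z: "rayleigh_maximizer M z"
    using rayleigh_maximizer_exists by blast
  have *: "quad_form M z / (z \<bullet> z) \<le> \<mu>"
    using \<mu>(2) rayleigh_maximizer_imp_eigenvector[OF sym z] by blast
  have "quad_form M y \<le> \<mu> * (y \<bullet> y)" for y
  proof -
    have "quad_form M y \<le> (quad_form M z / (z \<bullet> z)) * (y \<bullet> y)"
      using z by (simp add: rayleigh_maximizer_iff)
    also have "\<dots> \<le> \<mu> * (y \<bullet> y)"
      by (rule mult_right_mono[OF *]) simp
    finally show ?thesis .
  qed
  then show ?L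
    using R \<mu>(1) eigenvector_rayleigh[OF \<mu>(1)]
    by (simp add: rayleigh_maximizer_iff eigenvector_def)
qed

section \<open>Quadratic forms of Laplacians\<close>

lemma quad_form_sum: "quad_form M x = (\<Sum>i\<in>UNIV. \<Sum>j\<in>UNIV. M $ i $ j * x $ i * x $ j)"
  by (simp add: quad_form_def inner_vec_def matrix_vector_mult_def sum_distrib_left mult_ac)

text \<open>Expanding the square, each of the two pure squares sums to the degree form by symmetry.
  The half is there because the sum runs over ordered pairs. Diagonal entries of \<open>A\<close>
  cancel in \<open>laplacian A\<close> and multiply zero differences on the right.\<close>

lemma quad_form_laplacian:
  assumes "transpose A = A"
  shows "quad_form (laplacian A) x = (\<Sum>i\<in>UNIV. \<Sum>j\<in>UNIV. A $ i $ j * (x $ i - x $ j)\<^sup>2) / 2"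
proof -
  have A: "A $ i $ j = A $ j $ i" for i j
    using assms by (metis transpose_def vec_lambda_beta)
  define S where "S = (\<Sum>i\<in>UNIV. \<Sum>j\<in>UNIV. A $ i $ j * (x $ i)\<^sup>2)"
  have S: "(\<Sum>i\<in>UNIV. \<Sum>j\<in>UNIV. A $ i $ j * (x $ j)\<^sup>2) = S"
    unfolding S_def by (subst sum.swap) (simp add: A)
  have D: "quad_form (degree_matrix A) x = S"
  proof -
    have "(\<Sum>j\<in>UNIV. degree_matrix A $ i $ j * x $ i * x $ j) = (\<Sum>j\<in>UNIV. A $ i $ j * (x $ i)\<^sup>2)" for i
    proof -
      have "(\<Sum>j\<in>UNIV. degree_matrix A $ i $ j * x $ i * x $ j) =
          (\<Sum>j\<in>UNIV. if j = i then (\<Sum>k\<in>UNIV. A $ i $ k) * x $ i * x $ j else 0)"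
        by (rule sum.cong) (auto simp: degree_matrix_def)
      then show ?thesis
        by (simp add: sum_distrib_left sum_distrib_right power2_eq_square mult_ac)
    qed
    then show ?thesis
      by (simp add: quad_form_sum S_def)
  qed
  have "(\<Sum>i\<in>UNIV. \<Sum>j\<in>UNIV. A $ i $ j * (x $ i - x $ j)\<^sup>2) =
      (\<Sum>i\<in>UNIV. \<Sum>j\<in>UNIV. A $ i $ j * (x $ i)\<^sup>2 + A $ i $ j * (x $ j)\<^sup>2
        - 2 * (A $ i $ j * x $ i * x $ j))"
    by (intro sum.cong refl) (simp add: power2_eq_square algebra_simps)
  also have "\<dots> = S + S - 2 * quad_form A x"
    by (simp add: sum.distrib sum_subtractf S sum_distrib_left[symmetric] quad_form_sum)
      (simp add: S_def)
  finally show ?thesis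
    by (simp add: laplacian_def quad_form_diff D)
qed

lemma transpose_laplacian:
  assumes "transpose A = A"
  shows "transpose (laplacian A) = laplacian A"
proof -
  have A: "A $ i $ j = A $ j $ i" for i j
    using assms by (metis transpose_def vec_lambda_beta)
  show ?thesis
    by (auto simp: laplacian_def degree_matrix_def transpose_def vec_eq_iff A)
qed

section \<open>Forms of block diagonal and Kronecker matrices\<close>

lemma sum_prod_UNIV:
  "(\<Sum>i\<in>UNIV. f i) = (\<Sum>t\<in>UNIV. \<Sum>v\<in>UNIV. f (t, v))"
  by (simp add: sum.cartesian_product flip: UNIV_Times_UNIV)

lemma quad_form_block_diag:
  "quad_form (block_diag B) x = (\<Sum>t\<in>UNIV. quad_form (B t) (\<chi> v. x $ (t, v)))"
proof -
  have "(\<Sum>s\<in>UNIV. \<Sum>w\<in>UNIV. (if t = s then B t $ v $ w else 0) * x $ (t, v) * x $ (s, w)) =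
      (\<Sum>w\<in>UNIV. B t $ v $ w * x $ (t, v) * x $ (t, w))" for t v
  proof -
    have "(\<Sum>s\<in>UNIV. \<Sum>w\<in>UNIV. (if t = s then B t $ v $ w else 0) * x $ (t, v) * x $ (s, w)) =
        (\<Sum>s\<in>UNIV. if s = t then \<Sum>w\<in>UNIV. B t $ v $ w * x $ (t, v) * x $ (s, w) else 0)"
      by (rule sum.cong) auto
    then show ?thesis
      by simp
  qed
  then show ?thesis
    by (simp add: quad_form_sum sum_prod_UNIV block_diag_def cong: if_cong)
qed

lemma quad_form_kronecker_mat_1:
  "quad_form (kronecker A (mat 1)) x = (\<Sum>v\<in>UNIV. quad_form A (\<chi> t. x $ (t, v)))"
proof -
  have "(\<Sum>w\<in>UNIV. A $ t $ s * mat 1 $ v $ w * x $ (t, v) * x $ (s, w)) =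
      A $ t $ s * x $ (t, v) * x $ (s, v)" for t s v
  proof -
    have "(\<Sum>w\<in>UNIV. A $ t $ s * mat 1 $ v $ w * x $ (t, v) * x $ (s, w)) =
        (\<Sum>w\<in>UNIV. if w = v then A $ t $ s * x $ (t, v) * x $ (s, w) else 0)"
      by (rule sum.cong) (auto simp: mat_def)
    then show ?thesis
      by simp
  qed
  then have "quad_form (kronecker A (mat 1)) x =
      (\<Sum>t\<in>UNIV. \<Sum>v\<in>UNIV. \<Sum>s\<in>UNIV. A $ t $ s * x $ (t, v) * x $ (s, v))"
    by (simp add: quad_form_sum sum_prod_UNIV kronecker_def)
  then show ?thesis
    by (subst (asm) sum.swap) (simp add: quad_form_sum)
qed

lemma transpose_adjacency: "transpose (adjacency F w) = adjacency F w"
  by (simp add: adjacency_def transpose_def vec_eq_iff insert_commute)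

text \<open>The all-ones weights put a loop at every vertex. The loop raises the degree to
  \<open>CARD('v)\<close> and is subtracted again on the diagonal.\<close>

lemma complete_laplacian_eq: "complete_laplacian = laplacian (\<chi> u v. 1)"
  by (simp add: complete_laplacian_def laplacian_def degree_matrix_def vec_eq_iff mat_def)

lemma temporal_complete_eq: "temporal_complete = block_diag (\<lambda>t. complete_laplacian)"
  by (simp add: temporal_complete_def kronecker_def block_diag_def vec_eq_iff mat_def)

lemma quad_form_complete_laplacian:
  "quad_form complete_laplacian x = (\<Sum>a\<in>UNIV. \<Sum>b\<in>UNIV. (x $ a - x $ b)\<^sup>2) / 2"
  by (simp add: complete_laplacian_eq quad_form_laplacian transpose_def)

lemma quad_form_temporal_complete:
  "quad_form temporal_complete x =
    (\<Sum>t\<in>UNIV. \<Sum>a\<in>UNIV. \<Sum>b\<in>UNIV. (x $ (t, a) - x $ (t, b))\<^sup>2) / 2"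
  unfolding temporal_complete_eq quad_form_block_diag quad_form_complete_laplacian
  by (simp add: sum_divide_distrib)

definition path_weight :: "'m::linorder \<Rightarrow> 'm \<Rightarrow> real" where
  "path_weight s t = (if consecutive s t \<or> consecutive t s then 1 else 0)"

lemma path_laplacian_eq: "path_laplacian = laplacian (\<chi> s t. path_weight s t)"
  by (simp add: path_laplacian_def path_weight_def)

lemma transpose_path_weight: "transpose (\<chi> s t. path_weight s t) = (\<chi> s t. path_weight s t)"
  by (auto simp: transpose_def vec_eq_iff path_weight_def)

text \<open>The vertex sum stands innermost in the swap part, so that the splitting into block means
  can act on each pair of snapshots separately.\<close>

lemma quad_form_temporal_laplacian:
  "quad_form (temporal_laplacian E W \<beta>) x =
    (\<Sum>t\<in>UNIV. \<Sum>a\<in>UNIV. \<Sum>b\<in>UNIV.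
      adjacency (E t) (W t) $ a $ b * (x $ (t, a) - x $ (t, b))\<^sup>2) / 2 +
    \<beta> * (\<Sum>s\<in>UNIV. \<Sum>t\<in>UNIV. path_weight s t * (\<Sum>v\<in>UNIV. (x $ (s, v) - x $ (t, v))\<^sup>2)) / 2"
proof -
  have "(\<Sum>v\<in>UNIV. \<Sum>s\<in>UNIV. \<Sum>t\<in>UNIV. path_weight s t * (x $ (s, v) - x $ (t, v))\<^sup>2) =
      (\<Sum>s\<in>UNIV. \<Sum>t\<in>UNIV. \<Sum>v\<in>UNIV. path_weight s t * (x $ (s, v) - x $ (t, v))\<^sup>2)"
    by (subst sum.swap, rule sum.cong[OF refl], rule sum.swap)
  then show ?thesis
    by (simp add: temporal_laplacian_def quad_form_add quad_form_matrix_scaleR quad_form_block_diag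
        quad_form_kronecker_mat_1 path_laplacian_eq quad_form_laplacian transpose_adjacency
        transpose_path_weight sum_divide_distrib[symmetric] sum_distrib_left)
qed

section \<open>Symmetry of the matrices\<close>

lemma transpose_block_diag:
  assumes "\<And>t. transpose (B t) = B t"
  shows "transpose (block_diag B) = block_diag B"
proof -
  have "B t $ v $ w = B t $ w $ v" for t v w
    using assms by (metis transpose_def vec_lambda_beta)
  then show ?thesis
    by (auto simp: block_diag_def transpose_def vec_eq_iff)
qed

lemma transpose_kronecker: "transpose (kronecker A B) = kronecker (transpose A) (transpose B)"
  by (simp add: kronecker_def transpose_def vec_eq_iff)

lemma transpose_matrix_add: "transpose (A + B) = transpose A + transpose B"
  by (simp add: transpose_def vec_eq_iff)

lemma transpose_matrix_diff: "transpose (A - B) = transpose A - transpose B"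
  by (simp add: transpose_def vec_eq_iff)

lemma transpose_cut_matrix: "transpose (cut_matrix E W \<beta>) = cut_matrix E W \<beta>"
proof -
  have "transpose complete_laplacian = (complete_laplacian :: real ^ 'b ^ 'b)"
    unfolding complete_laplacian_eq by (rule transpose_laplacian) (simp add: transpose_def)
  then show ?thesis
    by (simp add: cut_matrix_def temporal_laplacian_def temporal_complete_def
        transpose_matrix_diff transpose_matrix_add transpose_scalar transpose_kronecker
        transpose_block_diag transpose_laplacian transpose_adjacency transpose_path_weight
        path_laplacian_eq)
qed

section \<open>Splitting into block means and deviations\<close>

text \<open>This is the orthogonal projection onto the vectors constant on every block, which form
  the kernel of \<open>temporal_complete\<close>.\<close>

definition block_mean :: "real ^ ('m::finite \<times> 'v::finite) \<Rightarrow> real ^ ('m \<times> 'v)" where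
  "block_mean x = (\<chi> i. (\<Sum>v\<in>UNIV. x $ (fst i, v)) / real CARD('v))"

lemma block_sum_deviation: "(\<Sum>v\<in>UNIV. (x - block_mean x) $ (t, v)) = 0"
  by (simp add: block_mean_def sum_subtractf)

text \<open>The cross term is \<open>2 * c\<close> times the sum of \<open>f\<close>. This is the
  orthogonality behind all the splittings below.\<close>

lemma sum_squares_shift:
  fixes f :: "'v::finite \<Rightarrow> real"
  assumes "sum f UNIV = 0"
  shows "(\<Sum>v\<in>UNIV. (c + f v)\<^sup>2) = real CARD('v) * c\<^sup>2 + (\<Sum>v\<in>UNIV. (f v)\<^sup>2)"
  by (simp add: power2_sum sum.distrib mult.assoc assms flip: sum_distrib_left)

text \<open>Differences inside a block do not see the block mean. Summing
  \<open>(p $ (t, a) - p $ (t, b))\<^sup>2\<close> over \<open>b\<close> leaves no cross term,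
  because the deviations of a block sum to zero.\<close>

lemma quad_form_temporal_complete_deviation:
  fixes x :: "real ^ ('m::finite \<times> 'v::finite)"
  defines "p \<equiv> x - block_mean x"
  shows "quad_form temporal_complete x = real CARD('v) * (p \<bullet> p)"
proof -
  have "(\<Sum>a\<in>UNIV. \<Sum>b\<in>UNIV. (x $ (t, a) - x $ (t, b))\<^sup>2) =
      2 * real CARD('v) * (\<Sum>v\<in>UNIV. (p $ (t, v))\<^sup>2)" for t
  proof -
    have *: "(\<Sum>b\<in>UNIV. - p $ (t, b)) = 0"
      using block_sum_deviation[of x t] unfolding sum_negf p_def by simp
    have "x $ (t, a) - x $ (t, b) = p $ (t, a) + - p $ (t, b)" for a b
      by (simp add: p_def block_mean_def)
    then have "(\<Sum>a\<in>UNIV. \<Sum>b\<in>UNIV. (x $ (t, a) - x $ (t, b))\<^sup>2) =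
        (\<Sum>a\<in>UNIV. \<Sum>b\<in>UNIV. (p $ (t, a) + - p $ (t, b))\<^sup>2)"
      by simp
    also have "\<dots> = 2 * real CARD('v) * (\<Sum>v\<in>UNIV. (p $ (t, v))\<^sup>2)"
      by (simp only: sum_squares_shift[OF *]) (simp add: sum.distrib sum_distrib_left[symmetric])
    finally show ?thesis .
  qed
  then show ?thesis
    by (simp add: quad_form_temporal_complete inner_vec_def sum_prod_UNIV power2_eq_square
        sum_distrib_left[symmetric])
qed

lemma quad_form_temporal_complete_block_mean: "quad_form temporal_complete (block_mean x) = 0"
  by (simp add: quad_form_temporal_complete block_mean_def)

lemma quad_form_temporal_complete_minus_block_mean:
  "quad_form temporal_complete (x - block_mean x) = quad_form temporal_complete x"
  by (simp add: quad_form_temporal_complete block_mean_def)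

text \<open>The snapshot part depends on differences inside blocks, hence on \<open>p\<close> alone.
  In the swap part the difference of two blocks is a constant from \<open>u\<close> plus a vector of
  sum zero from \<open>p\<close>, so the squares add.\<close>

lemma quad_form_temporal_laplacian_split:
  fixes x :: "real ^ ('m::{finite,linorder} \<times> 'v::finite)"
  shows "quad_form (temporal_laplacian E W \<beta>) x =
    quad_form (temporal_laplacian E W \<beta>) (block_mean x) +
    quad_form (temporal_laplacian E W \<beta>) (x - block_mean x)"
proof -
  define u p where "u = block_mean x" and "p = x - block_mean x"
  have "(\<Sum>v\<in>UNIV. (x $ (s, v) - x $ (t, v))\<^sup>2) =
      (\<Sum>v\<in>UNIV. (u $ (s, v) - u $ (t, v))\<^sup>2) + (\<Sum>v\<in>UNIV. (p $ (s, v) - p $ (t, v))\<^sup>2)" for s t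
  proof -
    obtain c where c: "\<And>v. u $ (s, v) - u $ (t, v) = c"
      by (simp add: u_def block_mean_def)
    have 0: "(\<Sum>v\<in>UNIV. p $ (s, v) - p $ (t, v)) = 0"
      using block_sum_deviation[of x s] block_sum_deviation[of x t]
      by (simp add: p_def sum_subtractf)
    have "x $ (s, v) - x $ (t, v) = c + (p $ (s, v) - p $ (t, v))" for v
      using c[of v] by (simp add: u_def p_def)
    then show ?thesis
      by (simp add: c sum_squares_shift[OF 0])
  qed
  then have swaps: "(\<Sum>s\<in>UNIV. \<Sum>t\<in>UNIV. path_weight s t * (\<Sum>v\<in>UNIV. (x $ (s, v) - x $ (t, v))\<^sup>2)) =
      (\<Sum>s\<in>UNIV. \<Sum>t\<in>UNIV. path_weight s t * (\<Sum>v\<in>UNIV. (u $ (s, v) - u $ (t, v))\<^sup>2)) +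
      (\<Sum>s\<in>UNIV. \<Sum>t\<in>UNIV. path_weight s t * (\<Sum>v\<in>UNIV. (p $ (s, v) - p $ (t, v))\<^sup>2))"
    by (simp add: sum.distrib distrib_left)
  have "x $ (t, a) - x $ (t, b) = p $ (t, a) - p $ (t, b)" for t a b
    by (simp add: p_def block_mean_def)
  moreover have "(\<Sum>t\<in>UNIV. \<Sum>a\<in>UNIV. \<Sum>b\<in>UNIV.
      adjacency (E t) (W t) $ a $ b * (u $ (t, a) - u $ (t, b))\<^sup>2) = 0"
    by (simp add: u_def block_mean_def)
  ultimately show ?thesis
    unfolding p_def[symmetric] unfolding u_def[symmetric] quad_form_temporal_laplacian swaps
    by (simp only: distrib_left add_divide_distrib)
qed

text \<open>On a vector constant on every block the edge weights, of either sign, contribute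
  nothing, and only the swap costs remain.\<close>

lemma quad_form_temporal_laplacian_block_mean_nonneg:
  assumes "\<beta> \<ge> 0"
  shows "quad_form (temporal_laplacian E W \<beta>) (block_mean x) \<ge> 0"
proof -
  have "(\<Sum>t\<in>UNIV. \<Sum>a\<in>UNIV. \<Sum>b\<in>UNIV.
      adjacency (E t) (W t) $ a $ b * (block_mean x $ (t, a) - block_mean x $ (t, b))\<^sup>2) = 0"
    by (simp add: block_mean_def)
  then show ?thesis
    using assms by (simp add: quad_form_temporal_laplacian path_weight_def sum_nonneg)
qed

lemma inner_split_block_mean:
  "x \<bullet> x = block_mean x \<bullet> block_mean x + (x - block_mean x) \<bullet> (x - block_mean x)"
proof -
  define p where "p = x - block_mean x"
  have "block_mean x \<bullet> p = (\<Sum>t\<in>UNIV. \<Sum>v\<in>UNIV. (\<Sum>w\<in>UNIV. x $ (t, w)) / real CARD('b) * p $ (t, v))"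
    by (simp add: inner_vec_def sum_prod_UNIV block_mean_def)
  also have "\<dots> = 0"
    by (simp only: sum_distrib_left[symmetric] p_def block_sum_deviation) simp
  finally have "(block_mean x + p) \<bullet> (block_mean x + p) = block_mean x \<bullet> block_mean x + p \<bullet> p"
    by (simp add: inner_add_left inner_add_right inner_commute)
  then show ?thesis
    by (simp add: p_def)
qed

section \<open>Optimality\<close>

lemma quad_form_cut_matrix:
  fixes x :: "real ^ ('m::{finite,linorder} \<times> 'v::finite)"
  shows "quad_form (cut_matrix E W \<beta>) x =
    3 * (real CARD('v) + 2 * \<beta>) * quad_form temporal_complete x
      - quad_form (temporal_laplacian E W \<beta>) x"
  by (simp add: cut_matrix_def quad_form_diff quad_form_matrix_scaleR)

text \<open>The test vector \<open>1\<close> has all entries 1, so every difference in both forms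
  vanishes.\<close>

lemma rayleigh_max_nonneg:
  assumes "rayleigh_maximizer (cut_matrix E W \<beta>) x"
  shows "quad_form (cut_matrix E W \<beta>) x / (x \<bullet> x) \<ge> 0"
proof -
  have "quad_form (cut_matrix E W \<beta>) 1 = 0"
    by (simp add: quad_form_cut_matrix quad_form_temporal_complete quad_form_temporal_laplacian)
  moreover have "(1 :: real ^ ('a \<times> 'b)) \<bullet> 1 > 0"
    by simp
  moreover have "quad_form (cut_matrix E W \<beta>) 1 \<le>
      quad_form (cut_matrix E W \<beta>) x / (x \<bullet> x) * ((1 :: real ^ ('a \<times> 'b)) \<bullet> 1)"
    using assms unfolding rayleigh_maximizer_iff by blast
  ultimately show ?thesis
    by (simp only: zero_le_mult_iff) linarith
qed

text \<open>With \<open>u\<close> the block means, additivity gives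
  \<open>- L(u) + M(p) = l * |u|^2 + l * |p|^2\<close>. Since
  \<open>- L(u) \<le> 0 \<le> l * |u|^2\<close> and \<open>M(p) \<le> l * |p|^2\<close>, all three
  inequalities are equalities.\<close>

lemma rayleigh_maximizer_parts:
  fixes x :: "real ^ ('m::{finite,linorder} \<times> 'v::finite)"
  assumes "\<beta> \<ge> 0" and max: "rayleigh_maximizer (cut_matrix E W \<beta>) x"
  defines "l \<equiv> quad_form (cut_matrix E W \<beta>) x / (x \<bullet> x)" and "p \<equiv> x - block_mean x"
  shows "quad_form (temporal_laplacian E W \<beta>) (block_mean x) = 0"
    and "l * (block_mean x \<bullet> block_mean x) = 0"
    and "quad_form (cut_matrix E W \<beta>) p = l * (p \<bullet> p)"
proof -
  let ?u = "block_mean x" and ?M = "cut_matrix E W \<beta>" and ?L = "temporal_laplacian E W \<beta>"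
  have le: "quad_form ?M y \<le> l * (y \<bullet> y)" for y
    using max by (simp add: rayleigh_maximizer_iff l_def)
  have "x \<noteq> 0"
    using max by (simp add: rayleigh_maximizer_iff)
  then have "quad_form ?M x = l * (x \<bullet> x)"
    by (simp add: l_def)
  moreover have "quad_form ?M x = quad_form ?M ?u + quad_form ?M p"
    unfolding p_def quad_form_cut_matrix quad_form_temporal_complete_block_mean
      quad_form_temporal_complete_minus_block_mean quad_form_temporal_laplacian_split[of E W \<beta> x]
    by simp
  moreover have "l * (x \<bullet> x) = l * (?u \<bullet> ?u) + l * (p \<bullet> p)"
    using inner_split_block_mean[of x] by (metis p_def distrib_left)
  ultimately have eq: "quad_form ?M ?u + quad_form ?M p = l * (?u \<bullet> ?u) + l * (p \<bullet> p)"
    by simp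
  have u: "quad_form ?M ?u = - quad_form ?L ?u"
    by (simp add: quad_form_cut_matrix quad_form_temporal_complete_block_mean)
  have "quad_form ?L ?u \<ge> 0"
    by (rule quad_form_temporal_laplacian_block_mean_nonneg[OF assms(1)])
  moreover have "l * (?u \<bullet> ?u) \<ge> 0"
    using rayleigh_max_nonneg[OF max] unfolding l_def by (intro mult_nonneg_nonneg) simp_all
  moreover have "a = 0 \<and> b = 0 \<and> m = c" if "a \<ge> 0" "b \<ge> 0" "- a + m = b + c" "m \<le> c" for a b c m :: real
    using that by linarith
  ultimately have "quad_form ?L ?u = 0 \<and> l * (?u \<bullet> ?u) = 0 \<and> quad_form ?M p = l * (p \<bullet> p)"
    using eq[unfolded u] le[of p] by blast
  then show "quad_form ?L ?u = 0" "l * (?u \<bullet> ?u) = 0" "quad_form ?M p = l * (p \<bullet> p)"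
    by simp_all
qed

text \<open>Positivity is assumed because for \<open>l = 0\<close> a constant vector is a maximizer
  too, and the cut ratio has denominator 0 there.\<close>

lemma rayleigh_maximizer_imp_relaxed_solution:
  fixes x :: "real ^ ('m::{finite,linorder} \<times> 'v::finite)"
  assumes \<beta>: "\<beta> \<ge> 0" and max: "rayleigh_maximizer (cut_matrix E W \<beta>) x"
    and pos: "quad_form temporal_complete x > 0"
  shows "relaxed_solution E W \<beta> x"
proof -
  let ?M = "cut_matrix E W \<beta>" and ?L = "temporal_laplacian E W \<beta>"
  let ?C = "temporal_complete :: real ^ ('m \<times> 'v) ^ ('m \<times> 'v)"
  define K where "K = 3 * (real CARD('v) + 2 * \<beta>)"
  define l where "l = quad_form ?M x / (x \<bullet> x)"
  \<comment> \<open>For a deviation \<open>p\<close> of \<open>y\<close>, the bound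
    \<open>M(p) \<le> l * |p|^2\<close> reads \<open>K * C(y) - L(p) \<le> l / n * C(y)\<close>,
    that is \<open>q * C(y) \<le> L(p)\<close>. At \<open>x\<close> it is an equality.\<close>
  define q where "q = K - l / real CARD('v)"
  have le: "quad_form ?M y \<le> l * (y \<bullet> y)" for y
    using max by (simp add: rayleigh_maximizer_iff l_def)
  have dev: "quad_form ?M (y - block_mean y) =
      K * quad_form ?C y - quad_form ?L (y - block_mean y)" for y
    by (simp add: quad_form_cut_matrix quad_form_temporal_complete_minus_block_mean K_def)
  have norm_dev: "l * ((y - block_mean y) \<bullet> (y - block_mean y)) =
      l / real CARD('v) * quad_form ?C y" for y :: "real ^ ('m \<times> 'v)"
    by (simp add: quad_form_temporal_complete_deviation)
  have "quad_form ?L x = quad_form ?L (x - block_mean x)"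
    using quad_form_temporal_laplacian_split[of E W \<beta> x] rayleigh_maximizer_parts(1)[OF \<beta> max]
    by simp
  also have "\<dots> = q * quad_form ?C x"
    using rayleigh_maximizer_parts(3)[OF \<beta> max] dev[of x] norm_dev[of x]
    by (simp add: q_def l_def[symmetric] left_diff_distrib)
  finally have x: "quad_form ?L x / quad_form ?C x = q"
    using pos by simp
  have "q \<le> quad_form ?L y / quad_form ?C y" if "quad_form ?C y > 0" for y
  proof -
    have "q * quad_form ?C y \<le> quad_form ?L (y - block_mean y)"
      using le[of "y - block_mean y"] dev[of y] norm_dev[of y]
      by (simp add: q_def left_diff_distrib)
    also have "\<dots> \<le> quad_form ?L y"
      using quad_form_temporal_laplacian_split[of E W \<beta> y]
        quad_form_temporal_laplacian_block_mean_nonneg[OF \<beta>, of E W y] by simp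
    finally show ?thesis
      using that by (simp add: pos_le_divide_eq)
  qed
  moreover have "\<forall>i. x $ i \<in> {-1..1}"
    using max unfolding rayleigh_maximizer_iff by blast
  ultimately show ?thesis
    unfolding relaxed_solution_def sparsest_cut_minimizer_def is_arg_min_def x
    using pos by (metis not_less)
qed

lemma quad_form_cut_matrix_pos:
  fixes E :: "'m::{finite,linorder} \<Rightarrow> 'v::finite set set"
  assumes "CARD('v) \<ge> 2" "\<beta> \<ge> 0"
    and W: "\<And>t e. e \<in> E t \<Longrightarrow> W t e < 3 * (real CARD('v) + 2 * \<beta>)"
  shows "\<exists>y. quad_form (cut_matrix E W \<beta>) y > 0"
proof -
  define K where "K = 3 * (real CARD('v) + 2 * \<beta>)"
  let ?A = "\<lambda>t. adjacency (E t) (W t)"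
  \<comment> \<open>Pairs that are not edges have entry 0, so the bound on all entries needs this
    besides the bound on the weights.\<close>
  have "K > 0"
    using assms(1,2) by (simp add: K_def)
  then have A: "?A t $ a $ b < K" for t a b
    using W by (simp add: adjacency_def K_def)
  obtain c d :: 'v where "c \<noteq> d"
    using assms(1) by (metis card_2_iff' ex_card UNIV_I)
  \<comment> \<open>The indicator of \<open>c\<close>, repeated in every snapshot, has no swap cost.
    Its form is a sum of nonnegative terms, and the pair \<open>c\<close>, \<open>d\<close>
    contributes a positive one.\<close>
  define y :: "real ^ ('m \<times> 'v)" where "y = (\<chi> i. if snd i = c then 1 else 0)"
  have "quad_form (cut_matrix E W \<beta>) y =
      (\<Sum>t\<in>UNIV. \<Sum>a\<in>UNIV. \<Sum>b\<in>UNIV. (K - ?A t $ a $ b) * (y $ (t, a) - y $ (t, b))\<^sup>2) / 2"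
  proof -
    have "y $ (s, v) = y $ (t, v)" for s t v
      by (simp add: y_def)
    then have "y $ (s, v) - y $ (t, v) = 0" for s t v
      by simp
    then have "quad_form (temporal_laplacian E W \<beta>) y =
        (\<Sum>t\<in>UNIV. \<Sum>a\<in>UNIV. \<Sum>b\<in>UNIV. ?A t $ a $ b * (y $ (t, a) - y $ (t, b))\<^sup>2) / 2"
      by (simp add: quad_form_temporal_laplacian del: eq_iff_diff_eq_0 right_minus_eq)
    then show ?thesis
      unfolding quad_form_cut_matrix quad_form_temporal_complete K_def[symmetric]
      by (simp add: left_diff_distrib sum_subtractf sum_distrib_left diff_divide_distrib)
  qed
  moreover have "\<dots> > 0"
  proof -
    have nonneg: "(K - ?A t $ a $ b) * (y $ (t, a) - y $ (t, b))\<^sup>2 \<ge> 0" for t a b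
      using A[of t a b] by simp
    have "(K - ?A t $ c $ d) * (y $ (t, c) - y $ (t, d))\<^sup>2 > 0" for t
      using A[of t c d] \<open>c \<noteq> d\<close> by (simp add: y_def)
    then have "(\<Sum>b\<in>UNIV. (K - ?A t $ c $ b) * (y $ (t, c) - y $ (t, b))\<^sup>2) > 0" for t
      using sum_pos2[of UNIV d "\<lambda>b. (K - ?A t $ c $ b) * (y $ (t, c) - y $ (t, b))\<^sup>2"]
      by (simp add: nonneg)
    then have "(\<Sum>a\<in>UNIV. \<Sum>b\<in>UNIV. (K - ?A t $ a $ b) * (y $ (t, a) - y $ (t, b))\<^sup>2) > 0" for t
      using sum_pos2[of UNIV c
          "\<lambda>a. \<Sum>b\<in>UNIV. (K - ?A t $ a $ b) * (y $ (t, a) - y $ (t, b))\<^sup>2"]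
      by (simp add: nonneg sum_nonneg)
    then show ?thesis
      by (simp add: sum_pos)
  qed
  ultimately show ?thesis
    by metis
qed

text \<open>The last two conjuncts secure a positive denominator in different ways, directly or by a
  bound on the weights. Some such condition is necessary: for one snapshot with two vertices and an
  edge heavier than \<open>3 * (2 + 2 * \<beta>)\<close>, only constant vectors maximize the
  Rayleigh quotient.\<close>

theorem theorem1:
  fixes E :: "'m::{finite,linorder} \<Rightarrow> 'v::finite set set"
    and W :: "'m \<Rightarrow> 'v set \<Rightarrow> real"
    and \<beta> :: real
  assumes "temporal_graph E"
    and "CARD('v) \<ge> 2"
    and "\<beta> \<ge> 0"
  shows "(\<exists>x. rayleigh_maximizer (cut_matrix E W \<beta>) x) \<and>
    (\<forall>x. rayleigh_maximizer (cut_matrix E W \<beta>) x \<longleftrightarrow>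
       (\<forall>i. x $ i \<in> {-1..1}) \<and> largest_eigenvector (cut_matrix E W \<beta>) x) \<and>
    (\<forall>x. rayleigh_maximizer (cut_matrix E W \<beta>) x \<and> quad_form temporal_complete x > 0
       \<longrightarrow> relaxed_solution E W \<beta> x) \<and>
    ((\<forall>t. \<forall>e \<in> E t. W t e < 3 * (real CARD('v) + 2 * \<beta>)) \<longrightarrow>
       (\<forall>x. rayleigh_maximizer (cut_matrix E W \<beta>) x \<longrightarrow> relaxed_solution E W \<beta> x))"
proof (intro conjI allI impI)
  let ?M = "cut_matrix E W \<beta>"
  show "\<exists>x. rayleigh_maximizer ?M x"
    by (rule rayleigh_maximizer_exists)
  show "rayleigh_maximizer ?M x \<longleftrightarrow> (\<forall>i. x $ i \<in> {-1..1}) \<and> largest_eigenvector ?M x" for x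
    by (rule rayleigh_maximizer_iff_largest_eigenvector[OF transpose_cut_matrix])
  show "relaxed_solution E W \<beta> x"
    if "rayleigh_maximizer ?M x \<and> quad_form temporal_complete x > 0" for x
    using that rayleigh_maximizer_imp_relaxed_solution[OF assms(3)] by blast
  show "relaxed_solution E W \<beta> x"
    if W: "\<forall>t. \<forall>e \<in> E t. W t e < 3 * (real CARD('v) + 2 * \<beta>)" and max: "rayleigh_maximizer ?M x" for x
  proof (rule rayleigh_maximizer_imp_relaxed_solution[OF assms(3) max])
    \<comment> \<open>One positive value makes the largest eigenvalue nonzero. Then the block means
      of \<open>x\<close> vanish, and the denominator at \<open>x\<close> is \<open>CARD('v)\<close>
      times its squared norm.\<close>
    obtain y where "quad_form ?M y > 0"
      using quad_form_cut_matrix_pos[OF assms(2,3)] W by blast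
    moreover have "quad_form ?M y \<le> quad_form ?M x / (x \<bullet> x) * (y \<bullet> y)"
      using max by (simp add: rayleigh_maximizer_iff)
    ultimately have "quad_form ?M x / (x \<bullet> x) \<noteq> 0"
      by auto
    then have "block_mean x = 0"
      using rayleigh_maximizer_parts(2)[OF assms(3) max] by (metis inner_eq_zero_iff mult_eq_0_iff)
    moreover have "x \<noteq> 0"
      using max by (simp add: rayleigh_maximizer_iff)
    ultimately show "quad_form temporal_complete x > 0"
      by (simp add: quad_form_temporal_complete_deviation)
  qed
qed

end
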